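(* For every integer $n\ge 0$, (i) $C_n(2)=|\mathrm{Bur}[n]|=|\mathrm{Mat}[n]|$; (ii) $C^{\circ}_n(2)=|\mathrm{Bur}^{01}[n]|=|\mathrm{Mat}^{01}[n]|$; (iii) $A_n(2)=|\mathrm{Bur}^{!}[n]|=|\mathrm{Mat}^{!}[n]|$.
   Context: Let $[n]=\{1,\dots,n\}$. A Cayley permutation on $[n]$ is a map $v:[n]\to[n]$ with image $[k]$ for some $k\le n$; it is identified with the word $v_1\cdots v_n$, $v_i=v(i)$. $\mathrm{Cay}[n]$ is the set of Cayley permutations on $[n]$, $\mathrm{Sym}[n]\subseteq\mathrm{Cay}[n]$ the set of permutations of $[n]$, and $\mathrm{I}[n]$ the set of weakly increasing Cayley permutations on $[n]$ (for $n=0$ each of these consists of the empty word only). For a word $v$ of length $n$: $D(v)=\{i\in[n-1]: v(i)\ge v(i+1)\}$ (weak descents), $D^{\circ}(v)=\{i\in[n-1]: v(i)>v(i+1)\}$ (strict descents), $\mathrm{des}(v)=|D(v)|$, $\mathrm{des}^{\circ}(v)=|D^{\circ}(v)|$. Polynomials: $A_n(t)=\sum_{v\in\mathrm{Sym}[n]}t^{\mathrm{des}(v)}$ (Eulerian), $C_n(t)=\sum_{v\in\mathrm{Cay}[n]}t^{\mathrm{des}(v)}$ (weak Caylerian), $C^{\circ}_n(t)=\sum_{v\in\mathrm{Cay}[n]}t^{\mathrm{des}^{\circ}(v)}$ (strict Caylerian). Burge words: $\mathrm{Bur}[n]=\{(u,v)\in\mathrm{I}[n]\times\mathrm{Cay}[n]: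 D(u)\subseteq D(v)\}$, $\mathrm{Bur}^{01}[n]=\{(u,v)\in\mathrm{Bur}[n]: D(u)\subseteq D^{\circ}(v)\}$, $\mathrm{Bur}^{!}[n]=\{(u,v)\in\mathrm{Bur}[n]: v\in\mathrm{Sym}[n]\}$. Burge matrices: $\mathrm{Mat}[n]$ is the set of matrices with nonnegative integer entries summing to $n$, in which every row and every column has at least one nonzero entry (for $n=0$ only the empty $0\times 0$ matrix); $\mathrm{Mat}^{01}[n]$ is the subset of those with all entries in $\{0,1\}$; $\mathrm{Mat}^{!}[n]$ is the subset of those in which every column sums to $1$. *)

theory Defs
  imports
    "HOL-Library.FuncSet"
    "HOL-Computational_Algebra.Polynomial"
    "Jordan_Normal_Form.Matrix"
begin

section \<open>Cayley permutations\<close>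

text \<open>
  A word of length \<open>n\<close> is an extensional map on \<open>{1..n}\<close>, so that equality of words is equality
  of functions and counting them is meaningful.  For \<open>n = 0\<close> there is exactly one such map.
\<close>

definition Cay :: "nat \<Rightarrow> (nat \<Rightarrow> nat) set" where
  "Cay n = {v \<in> {1..n} \<rightarrow>\<^sub>E {1..n}. \<exists>k\<le>n. v ` {1..n} = {1..k}}"

definition Sym :: "nat \<Rightarrow> (nat \<Rightarrow> nat) set" where
  "Sym n = {v \<in> {1..n} \<rightarrow>\<^sub>E {1..n}. bij_betw v {1..n} {1..n}}"

definition Inc :: "nat \<Rightarrow> (nat \<Rightarrow> nat) set" where
  "Inc n = {v \<in> Cay n. mono_on {1..n} v}"

lemma Sym_subset_Cay: "Sym n \<subseteq> Cay n"
  unfolding Sym_def Cay_def bij_betw_def by blast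

lemma Inc_subset_Cay: "Inc n \<subseteq> Cay n"
  unfolding Inc_def by blast

lemma finite_Cay: "finite (Cay n)"
proof (rule finite_subset)
  show "Cay n \<subseteq> {1..n} \<rightarrow>\<^sub>E {1..n}"
    unfolding Cay_def by blast
qed (simp add: finite_PiE)


section \<open>Descents\<close>

text \<open>
  The length \<open>n\<close> is an explicit argument of the descent sets.  For \<open>n = 0\<close> truncated subtraction
  gives the index set \<open>{1..n-1} = {1..0} = {}\<close>, as intended.
\<close>

definition weak_descents :: "nat \<Rightarrow> (nat \<Rightarrow> nat) \<Rightarrow> nat set" where
  "weak_descents n v = {i \<in> {1..n-1}. v i \<ge> v (i + 1)}"

definition strict_descents :: "nat \<Rightarrow> (nat \<Rightarrow> nat) \<Rightarrow> nat set" where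
  "strict_descents n v = {i \<in> {1..n-1}. v i > v (i + 1)}"

definition wdes :: "nat \<Rightarrow> (nat \<Rightarrow> nat) \<Rightarrow> nat" where
  "wdes n v = card (weak_descents n v)"

definition sdes :: "nat \<Rightarrow> (nat \<Rightarrow> nat) \<Rightarrow> nat" where
  "sdes n v = card (strict_descents n v)"


section \<open>Eulerian and Caylerian polynomials\<close>

definition Eulerian :: "nat \<Rightarrow> int poly" where
  "Eulerian n = (\<Sum>v\<in>Sym n. monom 1 (wdes n v))"

definition weak_Caylerian :: "nat \<Rightarrow> int poly" where
  "weak_Caylerian n = (\<Sum>v\<in>Cay n. monom 1 (wdes n v))"

definition strict_Caylerian :: "nat \<Rightarrow> int poly" where
  "strict_Caylerian n = (\<Sum>v\<in>Cay n. monom 1 (sdes n v))"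


section \<open>Burge words\<close>

definition Bur :: "nat \<Rightarrow> ((nat \<Rightarrow> nat) \<times> (nat \<Rightarrow> nat)) set" where
  "Bur n = {(u, v) \<in> Inc n \<times> Cay n. weak_descents n u \<subseteq> weak_descents n v}"

definition Bur01 :: "nat \<Rightarrow> ((nat \<Rightarrow> nat) \<times> (nat \<Rightarrow> nat)) set" where
  "Bur01 n = {(u, v) \<in> Bur n. weak_descents n u \<subseteq> strict_descents n v}"

definition Bur_perm :: "nat \<Rightarrow> ((nat \<Rightarrow> nat) \<times> (nat \<Rightarrow> nat)) set" where
  "Bur_perm n = {(u, v) \<in> Bur n. v \<in> Sym n}"


section \<open>Burge matrices\<close>

text \<open>
  The dimensions of the matrices are not fixed.  For \<open>n = 0\<close> the conditions on rows and columns
  leave only the matrix without rows and without columns.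
\<close>

definition Mat :: "nat \<Rightarrow> nat mat set" where
  "Mat n = {A. (\<Sum>i<dim_row A. \<Sum>j<dim_col A. A $$ (i, j)) = n \<and>
               (\<forall>i<dim_row A. \<exists>j<dim_col A. A $$ (i, j) \<noteq> 0) \<and>
               (\<forall>j<dim_col A. \<exists>i<dim_row A. A $$ (i, j) \<noteq> 0)}"

definition Mat01 :: "nat \<Rightarrow> nat mat set" where
  "Mat01 n = {A \<in> Mat n. elements_mat A \<subseteq> {0, 1}}"

definition Mat_perm :: "nat \<Rightarrow> nat mat set" where
  "Mat_perm n = {A \<in> Mat n. \<forall>j<dim_col A. (\<Sum>i<dim_row A. A $$ (i, j)) = 1}"

lemma Mat_0: "Mat 0 = carrier_mat 0 0"
proof (intro equalityI subsetI)
  fix A assume A: "A \<in> Mat 0"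
  then have z: "A $$ (i, j) = 0" if "i < dim_row A" "j < dim_col A" for i j
    using that by (simp add: Mat_def)
  have "dim_row A = 0" "dim_col A = 0"
    using A z by (force simp: Mat_def)+
  then show "A \<in> carrier_mat 0 0" by blast
qed (auto simp: Mat_def)

end

theory Submission
  imports Defs "HOL-Library.Multiset" "HOL-Library.Product_Lexorder"
begin

text \<open>
  Each of the three chains of equalities splits into an evaluation and a bijection.

  \<^emph>\<open>Evaluation at 2.\<close>  An increasing Cayley permutation \<open>u\<close> starts with the value 1 and at every
  further position either repeats its value (a weak descent) or rises by exactly 1.  So it is
  determined by its set of weak descents, and every subset of \<open>{1..n-1}\<close> occurs as such a set
  (\<open>bij_betw_weak_descents_Inc\<close>).  A fixed word \<open>v\<close> with descent set \<open>D\<close>, weak or strict, can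
  therefore be paired with exactly \<open>2 ^ card D\<close> words \<open>u\<close> whose weak descents lie in \<open>D\<close>, and
  \<open>2 ^ card D\<close> is the contribution of \<open>v\<close> to the descent polynomial at 2
  (\<open>descent_polynomial_at_2\<close>).

  \<^emph>\<open>Words and matrices.\<close>  Write a pair \<open>(u, v)\<close> of Cayley permutations as a biword, the list of
  its columns \<open>(u m, v m)\<close>.  It is a Burge word exactly when this list is sorted with first
  entries ascending and, among equal first entries, second entries descending
  (\<open>sorted_biword_iff\<close>).  A sorted list carries the same information as the multiset of its
  entries, and a multiset of pairs is the same as the matrix of its multiplicities.  Under this
  correspondence the images \<open>{1..k}\<close> and \<open>{1..l}\<close> of \<open>u\<close> and \<open>v\<close> become the index sets of the
  rows and columns, and every row and column is nonzero because these images have no gaps.  This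
  is the bijection \<open>bij_betw_burge_matrix\<close>.

  It restricts to the two subfamilies.  The entries are at most 1 iff the columns of the biword
  are distinct, that is, iff the sorting is strict, which puts the weak descents of \<open>u\<close> at strict
  descents of \<open>v\<close>.  The column sums are the multiplicities of the letters of \<open>v\<close>, so they are
  all 1 iff \<open>v\<close> is injective, hence a permutation.
\<close>

section \<open>Increasing Cayley permutations and subsets\<close>

text \<open>
  A value below \<open>u i\<close> is attained somewhere because the image of \<open>u\<close> has no gaps, and by
  monotonicity it is attained up to position \<open>i\<close>.  This is what limits each step of \<open>u\<close> to at
  most 1.
\<close>

lemma Inc_image_initial:
  assumes u: "u \<in> Inc n" and i: "i \<in> {1..n}"
  shows "u ` {1..i} = {1..u i}"
proof -
  obtain k where k: "u ` {1..n} = {1..k}"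
    using u by (auto simp: Inc_def Cay_def)
  have mono: "u x \<le> u y" if "x \<in> {1..n}" "y \<in> {1..n}" "x \<le> y" for x y
    using u that by (simp add: Inc_def mono_on_def)
  show ?thesis
  proof (intro equalityI subsetI)
    fix y assume "y \<in> u ` {1..i}"
    then obtain j where j: "j \<in> {1..i}" "y = u j" by blast
    have "u j \<in> {1..k}" using k j i by (metis atLeastAtMost_iff image_eqI le_trans)
    then show "y \<in> {1..u i}" using j i mono[of j i] by auto
  next
    fix y assume y: "y \<in> {1..u i}"
    have "u i \<in> {1..k}" using k i by blast
    then have "y \<in> u ` {1..n}" using y k by auto
    then obtain j where j: "j \<in> {1..n}" "y = u j" by blast
    show "y \<in> u ` {1..i}"
    proof (cases "j \<le> i")
      case True then show ?thesis using j by auto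
    next
      case False
      then have "y = u i" using mono[of i j] i j y by auto
      then show ?thesis using i by auto
    qed
  qed
qed

text \<open>
  The explicit inverse of the passage to weak descents: \<open>u\<close> starts at 1 and grows by 1 at each
  position that is not a weak descent.
\<close>

lemma Inc_eq_card_ascents:
  assumes u: "u \<in> Inc n" and i: "i \<in> {1..n}"
  shows "u i = Suc (card ({1..<i} - weak_descents n u))"
  using i
proof (induction i)
  case 0
  then show ?case by simp
next
  case (Suc i)
  show ?case
  proof (cases "i = 0")
    case True
    then have "{1..u 1} = {u 1}" using Inc_image_initial[OF u Suc.prems] by simp
    then have "u 1 = 1" by (metis atLeastAtMost_singleton_iff)
    with True show ?thesis by simp
  next
    case False
    then have i: "i \<in> {1..n}" using Suc.prems by auto
    have "{1..u (Suc i)} = insert (u (Suc i)) {1..u i}"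
      using Inc_image_initial[OF u Suc.prems] Inc_image_initial[OF u i]
      by (simp add: atLeastAtMostSuc_conv)
    then have "card {1..u (Suc i)} \<le> Suc (card {1..u i})"
      by (metis card_insert_le_m1 card_insert_if finite_atLeastAtMost le_SucI order_refl)
    then have up: "u (Suc i) \<le> Suc (u i)" by simp
    have down: "u i \<le> u (Suc i)"
      using u i Suc.prems by (simp add: Inc_def mono_on_def)
    have D: "i \<in> weak_descents n u \<longleftrightarrow> u (Suc i) = u i"
      using i Suc.prems down by (auto simp: weak_descents_def)
    have "{1..<Suc i} = insert i {1..<i}" using i by auto
    then show ?thesis using Suc.IH[OF i] up down D
      by (cases "i \<in> weak_descents n u") (auto simp: insert_Diff_if)
  qed
qed

lemma exists_Inc_with_weak_descents:
  assumes S: "S \<subseteq> {1..n - 1}"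
  shows "\<exists>u\<in>Inc n. weak_descents n u = S"
proof -
  define u where "u = (\<lambda>i\<in>{1..n}. Suc (card ({1..<i} - S)))"
  have u: "u i = Suc (card ({1..<i} - S))" if "i \<in> {1..n}" for i
    using that by (simp add: u_def)
  have step: "u (Suc i) = (if i \<in> S then u i else Suc (u i))" if "i \<in> {1..n}" "Suc i \<in> {1..n}" for i
  proof -
    have "{1..<Suc i} = insert i {1..<i}" using that by auto
    then show ?thesis using u[OF that(1)] u[OF that(2)] by (simp add: insert_Diff_if)
  qed
  have image: "u ` {1..i} = {1..u i}" if "i \<in> {1..n}" for i
    using that
  proof (induction i)
    case (Suc i)
    show ?case
    proof (cases "i = 0")
      case True then show ?thesis using u[OF Suc.prems] by simp
    next
      case False
      then have "i \<in> {1..n}" using Suc.prems by auto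
      moreover have "1 \<le> u i" using u[OF \<open>i \<in> {1..n}\<close>] by simp
      ultimately show ?thesis using Suc step[of i]
        by (auto simp: atLeastAtMostSuc_conv)
    qed
  qed simp
  have le: "u i \<le> i" if "i \<in> {1..n}" for i
  proof -
    have "card ({1..<i} - S) \<le> card {1..<i}" by (rule card_mono) auto
    then show ?thesis using that u[OF that] by auto
  qed
  have "\<exists>k\<le>n. u ` {1..n} = {1..k}"
    using image[of n] le[of n] by (cases "n = 0") auto
  moreover have "u \<in> {1..n} \<rightarrow>\<^sub>E {1..n}"
    using u le by (force simp: u_def PiE_iff)
  moreover have "mono_on {1..n} u"
    by (intro mono_onI) (auto simp: u_def intro!: card_mono)
  ultimately have "u \<in> Inc n" by (simp add: Inc_def Cay_def)
  moreover have "weak_descents n u = S"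
    using S step by (fastforce simp: weak_descents_def split: if_splits)
  ultimately show ?thesis by blast
qed

lemma bij_betw_weak_descents_Inc: "bij_betw (weak_descents n) (Inc n) (Pow {1..n - 1})"
proof (rule bij_betw_imageI)
  show "inj_on (weak_descents n) (Inc n)"
  proof (rule inj_onI)
    fix u v assume u: "u \<in> Inc n" and v: "v \<in> Inc n" and eq: "weak_descents n u = weak_descents n v"
    have "u i = v i" if "i \<in> {1..n}" for i
      using Inc_eq_card_ascents[OF u that] Inc_eq_card_ascents[OF v that] eq by simp
    moreover have "u \<in> extensional {1..n}" "v \<in> extensional {1..n}"
      using u v by (auto simp: Inc_def Cay_def PiE_iff)
    ultimately show "u = v" by (metis extensionalityI)
  qed
  show "weak_descents n ` Inc n = Pow {1..n - 1}"
  proof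
    show "weak_descents n ` Inc n \<subseteq> Pow {1..n - 1}" by (auto simp: weak_descents_def)
    show "Pow {1..n - 1} \<subseteq> weak_descents n ` Inc n"
    proof
      fix S assume "S \<in> Pow {1..n - 1}"
      then obtain u where "u \<in> Inc n" "weak_descents n u = S"
        using exists_Inc_with_weak_descents by blast
      then show "S \<in> weak_descents n ` Inc n" by blast
    qed
  qed
qed

text \<open>
  This is the source of the number 2: for each descent of \<open>v\<close> there is a free choice whether
  \<open>u\<close> descends there as well.
\<close>

lemma card_Inc_weak_descents_subset:
  assumes "S \<subseteq> {1..n - 1}"
  shows "card {u \<in> Inc n. weak_descents n u \<subseteq> S} = 2 ^ card S"
proof -
  have "bij_betw (weak_descents n) {u \<in> Inc n. weak_descents n u \<subseteq> S} (Pow S)"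
  proof (rule bij_betw_subset[OF bij_betw_weak_descents_Inc])
    show "weak_descents n ` {u \<in> Inc n. weak_descents n u \<subseteq> S} = Pow S"
    proof
      show "Pow S \<subseteq> weak_descents n ` {u \<in> Inc n. weak_descents n u \<subseteq> S}"
      proof
        fix T assume T: "T \<in> Pow S"
        then obtain u where "u \<in> Inc n" "weak_descents n u = T"
          using exists_Inc_with_weak_descents[of T n] assms by blast
        then show "T \<in> weak_descents n ` {u \<in> Inc n. weak_descents n u \<subseteq> S}"
          using T by blast
      qed
    qed blast
  qed blast
  then have "card {u \<in> Inc n. weak_descents n u \<subseteq> S} = card (Pow S)"
    by (rule bij_betw_same_card)
  moreover have "finite S" using assms by (rule finite_subset) simp
  ultimately show ?thesis by (simp add: card_Pow)
qed

text \<open>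
  The set \<open>V\<close> and the descent statistic \<open>d\<close> are left open so that the same count serves the
  weak Caylerian, the strict Caylerian and the Eulerian polynomial.
\<close>

lemma descent_polynomial_at_2:
  assumes "finite V" and d: "\<And>v. v \<in> V \<Longrightarrow> d v \<subseteq> {1..n - 1}"
  shows "poly (\<Sum>v\<in>V. monom 1 (card (d v))) (2 :: int)
       = int (card {(u, v) \<in> Inc n \<times> V. weak_descents n u \<subseteq> d v})"
proof -
  have fin: "finite {u \<in> Inc n. P u}" for P
    using finite_subset[OF Inc_subset_Cay finite_Cay] by simp
  have "bij_betw prod.swap (SIGMA v:V. {u \<in> Inc n. weak_descents n u \<subseteq> d v})
          {(u, v) \<in> Inc n \<times> V. weak_descents n u \<subseteq> d v}"
    by (rule bij_betw_imageI) force+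
  then have "card {(u, v) \<in> Inc n \<times> V. weak_descents n u \<subseteq> d v}
      = card (SIGMA v:V. {u \<in> Inc n. weak_descents n u \<subseteq> d v})"
    by (rule bij_betw_same_card[symmetric])
  also have "\<dots> = (\<Sum>v\<in>V. 2 ^ card (d v))"
    using assms fin by (simp add: card_Inc_weak_descents_subset)
  finally show ?thesis by (simp add: poly_sum poly_monom)
qed

section \<open>Biwords in canonical order\<close>

definition biword :: "nat \<Rightarrow> (nat \<Rightarrow> nat) \<Rightarrow> (nat \<Rightarrow> nat) \<Rightarrow> (nat \<times> nat) list" where
  "biword n u v = map (\<lambda>m. (u m, v m)) [1..<Suc n]"

text \<open>
  Sorting by this key in the lexicographic order puts first entries in ascending and, within
  equal first entries, second entries in descending order; hence the sign.
\<close>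

definition burge_key :: "nat \<times> nat \<Rightarrow> nat \<times> int" where
  "burge_key p = (fst p, - int (snd p))"

lemma inj_burge_key: "inj burge_key"
  by (auto simp: inj_def burge_key_def)

lemma length_biword [simp]: "length (biword n u v) = n"
  by (simp add: biword_def)

lemma map_snd_biword: "map snd (biword n u v) = map v [1..<Suc n]"
  by (simp add: biword_def)

lemma set_biword: "set (biword n u v) = (\<lambda>m. (u m, v m)) ` {1..n}"
  by (simp add: biword_def atLeastLessThanSuc_atLeastAtMost del: upt_Suc)

lemma fst_set_biword: "fst ` set (biword n u v) = u ` {1..n}"
  and snd_set_biword: "snd ` set (biword n u v) = v ` {1..n}"
  by (simp_all add: set_biword image_image)

lemma nth_biword: "i < n \<Longrightarrow> biword n u v ! i = (u (Suc i), v (Suc i))"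
  by (simp add: biword_def del: upt_Suc)

text \<open>
  Where a weakly increasing \<open>u\<close> rises, the keys increase whatever \<open>v\<close> does; where it stays
  constant, which is at its weak descents, sortedness asks for a weak descent of \<open>v\<close>.
\<close>

lemma sorted_biword_iff:
  "sorted (map burge_key (biword n u v)) \<longleftrightarrow>
     mono_on {1..n} u \<and> weak_descents n u \<subseteq> weak_descents n v"
proof
  assume sorted: "sorted (map burge_key (biword n u v))"
  have le: "burge_key (u x, v x) \<le> burge_key (u y, v y)" if "x \<in> {1..n}" "y \<in> {1..n}" "x \<le> y" for x y
    using sorted_nth_mono[OF sorted, of "x - 1" "y - 1"] that by (auto simp: nth_biword)
  have "mono_on {1..n} u"
    using le by (intro mono_onI) (fastforce simp: burge_key_def)
  moreover have "weak_descents n u \<subseteq> weak_descents n v"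
  proof
    fix i assume i: "i \<in> weak_descents n u"
    then have "burge_key (u i, v i) \<le> burge_key (u (i + 1), v (i + 1))"
      by (intro le) (auto simp: weak_descents_def)
    with i show "i \<in> weak_descents n v"
      by (auto simp: weak_descents_def burge_key_def)
  qed
  ultimately show "mono_on {1..n} u \<and> weak_descents n u \<subseteq> weak_descents n v" ..
next
  assume R: "mono_on {1..n} u \<and> weak_descents n u \<subseteq> weak_descents n v"
  have "burge_key (u (Suc i), v (Suc i)) \<le> burge_key (u (Suc (Suc i)), v (Suc (Suc i)))"
    if "Suc i < n" for i
  proof (cases "Suc i \<in> weak_descents n u")
    case True
    then have "v (Suc i) \<ge> v (Suc (Suc i))" using R by (auto simp: weak_descents_def)
    moreover have "u (Suc i) \<le> u (Suc (Suc i))" using R that by (simp add: mono_on_def)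
    ultimately show ?thesis by (auto simp: burge_key_def)
  next
    case False
    then show ?thesis using that by (auto simp: burge_key_def weak_descents_def)
  qed
  then show "sorted (map burge_key (biword n u v))"
    by (simp add: sorted_iff_nth_Suc nth_biword)
qed

text \<open>
  In a sorted biword equal columns are adjacent, so it suffices to compare neighbours: they
  coincide exactly where \<open>u\<close> and \<open>v\<close> both stay constant.
\<close>

lemma distinct_biword_iff:
  assumes sorted: "sorted (map burge_key (biword n u v))"
  shows "distinct (biword n u v) \<longleftrightarrow> weak_descents n u \<subseteq> strict_descents n v"
proof
  have mono: "mono_on {1..n} u" and sub: "weak_descents n u \<subseteq> weak_descents n v"
    using sorted unfolding sorted_biword_iff by auto
  {
    assume dist: "distinct (biword n u v)"
    show "weak_descents n u \<subseteq> strict_descents n v"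
    proof
      fix i assume i: "i \<in> weak_descents n u"
      then have bounds: "1 \<le> i" "i < n" by (auto simp: weak_descents_def)
      have "u i = u (Suc i)"
        using i mono_onD[OF mono, of i "Suc i"] bounds by (auto simp: weak_descents_def)
      moreover have "(u i, v i) \<noteq> (u (Suc i), v (Suc i))"
        using nth_eq_iff_index_eq[OF dist, of "i - 1" i] bounds by (simp add: nth_biword)
      moreover have "v i \<ge> v (Suc i)" using i sub by (auto simp: weak_descents_def)
      ultimately show "i \<in> strict_descents n v"
        using bounds by (auto simp: strict_descents_def)
    qed
  next
    assume S: "weak_descents n u \<subseteq> strict_descents n v"
    have "burge_key (u (Suc i), v (Suc i)) < burge_key (u (Suc (Suc i)), v (Suc (Suc i)))"
      if "Suc i < n" for i
    proof (cases "Suc i \<in> weak_descents n u")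
      case True
      then have "v (Suc i) > v (Suc (Suc i))" using S by (auto simp: strict_descents_def)
      moreover have "u (Suc i) \<le> u (Suc (Suc i))" using mono that by (simp add: mono_on_def)
      ultimately show ?thesis by (auto simp: burge_key_def)
    next
      case False
      then show ?thesis using that by (auto simp: burge_key_def weak_descents_def)
    qed
    then have "sorted_wrt (<) (map burge_key (biword n u v))"
      by (simp add: sorted_wrt_iff_nth_Suc_transp nth_biword)
    then show "distinct (biword n u v)"
      by (simp add: strict_sorted_iff distinct_map)
  }
qed

lemma biword_inject:
  assumes "u \<in> extensional {1..n}" "v \<in> extensional {1..n}"
    and "u' \<in> extensional {1..n}" "v' \<in> extensional {1..n}"
    and "biword n u v = biword n u' v'"
  shows "u = u'" "v = v'"
proof -
  have "(u i, v i) = (u' i, v' i)" if "i \<in> {1..n}" for i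
    using arg_cong[OF assms(5), of "\<lambda>xs. xs ! (i - 1)"] that
      nth_biword[of "i - 1" n u v] nth_biword[of "i - 1" n u' v'] by auto
  then show "u = u'" "v = v'"
    using assms(1-4) by (blast intro: extensionalityI)+
qed

lemma exists_biword:
  assumes "length xs = n"
  shows "\<exists>u\<in>extensional {1..n}. \<exists>v\<in>extensional {1..n}. biword n u v = xs"
proof (intro bexI)
  show "biword n (\<lambda>m\<in>{1..n}. fst (xs ! (m - 1))) (\<lambda>m\<in>{1..n}. snd (xs ! (m - 1))) = xs"
    using assms by (intro nth_equalityI) (simp_all add: nth_biword)
qed simp_all

text \<open>
  The bounds on the values and on \<open>k\<close> come for free, since a word of length \<open>n\<close> has at most
  \<open>n\<close> different letters.
\<close>

lemma Cay_iff:
  "v \<in> Cay n \<longleftrightarrow> v \<in> extensional {1..n} \<and> (\<exists>k. v ` {1..n} = {1..k})"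
proof
  assume "v \<in> extensional {1..n} \<and> (\<exists>k. v ` {1..n} = {1..k})"
  then obtain k where ext: "v \<in> extensional {1..n}" and k: "v ` {1..n} = {1..k}" by blast
  have "k \<le> n" using card_image_le[of "{1..n}" v] k by simp
  moreover from this have "v i \<in> {1..n}" if "i \<in> {1..n}" for i
    using imageI[OF that, of v] k by auto
  ultimately show "v \<in> Cay n" using ext k by (auto simp: Cay_def PiE_iff)
qed (auto simp: Cay_def PiE_iff)

lemma Sym_iff_inj_on:
  assumes "v \<in> Cay n"
  shows "v \<in> Sym n \<longleftrightarrow> inj_on v {1..n}"
proof
  assume inj: "inj_on v {1..n}"
  obtain k where k: "v ` {1..n} = {1..k}" using assms by (auto simp: Cay_def)
  then have "k = n" using card_image[OF inj] by simp
  then show "v \<in> Sym n" using assms inj k by (auto simp: Sym_def Cay_def bij_betw_def)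
qed (auto simp: Sym_def bij_betw_def)

text \<open>
  Monotonicity of \<open>u\<close> and the inclusion of the descent sets merge into one sorting condition;
  this is the form in which Burge words are compared with matrices.
\<close>

lemma Bur_iff:
  "(u, v) \<in> Bur n \<longleftrightarrow> u \<in> Cay n \<and> v \<in> Cay n \<and> sorted (map burge_key (biword n u v))"
  by (auto simp: Bur_def Inc_def sorted_biword_iff)

section \<open>From Burge words to Burge matrices\<close>

lemma sum_count_list_pairs:
  assumes "finite A" "fst ` set xs \<subseteq> A"
  shows "(\<Sum>a\<in>A. count_list xs (a, b)) = count_list (map snd xs) b"
  using assms(2)
proof (induction xs)
  case (Cons x xs)
  have "(\<Sum>a\<in>A. count_list (x # xs) (a, b))
      = (\<Sum>a\<in>A. if a = fst x then (if snd x = b then 1 else 0) else 0) + (\<Sum>a\<in>A. count_list xs (a, b))"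
    unfolding sum.distrib[symmetric] by (rule sum.cong) (auto simp: prod_eq_iff)
  then show ?case using Cons assms(1) by simp
qed simp

text \<open>
  For Cayley permutations the images are \<open>{1..k}\<close> and \<open>{1..l}\<close>, so the two cardinalities are the
  largest letters of \<open>u\<close> and \<open>v\<close>.  The successors translate matrix indices, which start at 0,
  into letters, which start at 1.
\<close>

definition burge_matrix :: "nat \<Rightarrow> (nat \<Rightarrow> nat) \<times> (nat \<Rightarrow> nat) \<Rightarrow> nat mat" where
  "burge_matrix n = (\<lambda>(u, v). mat (card (u ` {1..n})) (card (v ` {1..n}))
     (\<lambda>(i, j). count_list (biword n u v) (Suc i, Suc j)))"

text \<open>
  Adding up a column forgets the first entries of the biword and so leaves the number of
  occurrences of a letter in \<open>v\<close>.
\<close>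

lemma burge_matrix_column_sum:
  assumes "u ` {1..n} = {1..k}" "v ` {1..n} = {1..l}" "j < l"
  shows "(\<Sum>i<k. burge_matrix n (u, v) $$ (i, j)) = count_list (map v [1..<Suc n]) (Suc j)"
proof -
  have "(\<Sum>i<k. burge_matrix n (u, v) $$ (i, j)) = (\<Sum>i<k. count_list (biword n u v) (Suc i, Suc j))"
    using assms by (intro sum.cong) (auto simp: burge_matrix_def)
  also have "\<dots> = (\<Sum>a\<in>{1..k}. count_list (biword n u v) (a, Suc j))"
    by (simp add: sum.atLeast1_atMost_eq)
  also have "\<dots> = count_list (map v [1..<Suc n]) (Suc j)"
    using assms by (subst sum_count_list_pairs) (simp_all add: fst_set_biword map_snd_biword del: upt_Suc)
  finally show ?thesis .
qed

lemma count_list_pos_iff: "0 < count_list xs x \<longleftrightarrow> x \<in> set xs"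
  by (metis count_list_0_iff gr0I less_numeral_extra(3))

lemma burge_matrix_in_Mat:
  assumes "(u, v) \<in> Bur n"
  shows "burge_matrix n (u, v) \<in> Mat n"
proof -
  obtain k l where k: "u ` {1..n} = {1..k}" and l: "v ` {1..n} = {1..l}"
    using assms by (auto simp: Bur_iff Cay_iff)
  have dim: "dim_row (burge_matrix n (u, v)) = k" "dim_col (burge_matrix n (u, v)) = l"
    using k l by (simp_all add: burge_matrix_def)
  have nonzero: "burge_matrix n (u, v) $$ (i, j) \<noteq> 0 \<longleftrightarrow> (\<exists>m\<in>{1..n}. u m = Suc i \<and> v m = Suc j)"
    if "i < k" "j < l" for i j
  proof -
    have "burge_matrix n (u, v) $$ (i, j) = count_list (biword n u v) (Suc i, Suc j)"
      using that k l by (simp add: burge_matrix_def)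
    then have "burge_matrix n (u, v) $$ (i, j) \<noteq> 0 \<longleftrightarrow> (Suc i, Suc j) \<in> set (biword n u v)"
      by (simp only: count_list_0_iff not_not)
    then show ?thesis unfolding set_biword image_iff by (metis prod.inject)
  qed
  have "(\<Sum>i<k. \<Sum>j<l. burge_matrix n (u, v) $$ (i, j))
      = (\<Sum>j<l. \<Sum>i<k. burge_matrix n (u, v) $$ (i, j))"
    by (rule sum.swap)
  also have "\<dots> = (\<Sum>b\<in>{1..l}. count_list (map v [1..<Suc n]) b)"
    using k l by (simp add: burge_matrix_column_sum sum.atLeast1_atMost_eq del: upt_Suc)
  also have "\<dots> = n"
    using l by (subst sum_count_set) (simp_all add: atLeastLessThanSuc_atLeastAtMost del: upt_Suc)
  finally have sum: "(\<Sum>i<k. \<Sum>j<l. burge_matrix n (u, v) $$ (i, j)) = n" .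
  have rows: "\<exists>j<l. burge_matrix n (u, v) $$ (i, j) \<noteq> 0" if i: "i < k" for i
  proof -
    have "Suc i \<in> u ` {1..n}" using i k by auto
    then obtain m where m: "m \<in> {1..n}" "u m = Suc i" by auto
    then have "v m \<in> {1..l}" using l by blast
    then obtain j where "v m = Suc j" "j < l" by (cases "v m") auto
    then show ?thesis using nonzero[OF i] m by blast
  qed
  have cols: "\<exists>i<k. burge_matrix n (u, v) $$ (i, j) \<noteq> 0" if j: "j < l" for j
  proof -
    have "Suc j \<in> v ` {1..n}" using j l by auto
    then obtain m where m: "m \<in> {1..n}" "v m = Suc j" by auto
    then have "u m \<in> {1..k}" using k by blast
    then obtain i where "u m = Suc i" "i < k" by (cases "u m") auto
    then show ?thesis using nonzero[OF _ j] m by blast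
  qed
  show ?thesis using sum rows cols by (simp add: Mat_def dim)
qed

text \<open>
  The matrix records the multiplicity of every pair, because no pair outside the index range
  occurs in the biword.
\<close>

lemma count_list_biword_eq_entry:
  assumes "u ` {1..n} = {1..k}" "v ` {1..n} = {1..l}"
  shows "count_list (biword n u v) (a, b)
       = (if a \<in> {1..k} \<and> b \<in> {1..l} then burge_matrix n (u, v) $$ (a - 1, b - 1) else 0)"
proof (cases "a \<in> {1..k} \<and> b \<in> {1..l}")
  case True
  then show ?thesis using assms by (auto simp: burge_matrix_def)
next
  case False
  have "(a, b) \<notin> set (biword n u v)"
  proof
    assume "(a, b) \<in> set (biword n u v)"
    then have "a \<in> fst ` set (biword n u v)" "b \<in> snd ` set (biword n u v)" by force+
    then show False using False assms by (simp add: fst_set_biword snd_set_biword)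
  qed
  then have "count_list (biword n u v) (a, b) = 0" by (simp only: count_list_0_iff not_False_eq_True)
  then show ?thesis using False by (simp only: if_False)
qed

text \<open>
  The matrix determines the multiset of columns of the biword, and there is only one sorted
  arrangement of a multiset.
\<close>

lemma inj_on_burge_matrix: "inj_on (burge_matrix n) (Bur n)"
proof (rule inj_onI, clarify)
  fix u v u' v'
  assume uv: "(u, v) \<in> Bur n" and uv': "(u', v') \<in> Bur n"
    and eq: "burge_matrix n (u, v) = burge_matrix n (u', v')"
  obtain k l where kl: "u ` {1..n} = {1..k}" "v ` {1..n} = {1..l}"
    using uv by (auto simp: Bur_iff Cay_iff)
  obtain k' l' where kl': "u' ` {1..n} = {1..k'}" "v' ` {1..n} = {1..l'}"
    using uv' by (auto simp: Bur_iff Cay_iff)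
  have "k = k'" "l = l'"
    using arg_cong[OF eq, of dim_row] arg_cong[OF eq, of dim_col] kl kl'
    by (simp_all add: burge_matrix_def)
  then have "count_list (biword n u v) p = count_list (biword n u' v') p" for p
    using count_list_biword_eq_entry[OF kl] count_list_biword_eq_entry[OF kl'] eq
    by (cases p) simp
  then have "mset (biword n u v) = mset (biword n u' v')"
    by (intro multiset_eqI) (simp add: count_mset)
  then have "map burge_key (biword n u v) = map burge_key (biword n u' v')"
    using uv uv' properties_for_sort[of "map burge_key (biword n u v)" "map burge_key (biword n u' v')"]
    by (simp add: Bur_iff sorted_sort_id)
  then have "biword n u v = biword n u' v'"
    by (rule map_injective[OF _ inj_burge_key])
  then show "u = u' \<and> v = v'"
    using uv uv' biword_inject[of u n v u' v'] by (auto simp: Bur_iff Cay_iff)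
qed

text \<open>
  The preimage of a matrix is obtained by sorting the multiset whose multiplicities are its
  entries.  Its nonzero rows and columns make the two words Cayley permutations, and the sum
  of the entries is their length.
\<close>

lemma Mat_subset_burge_matrix: "Mat n \<subseteq> burge_matrix n ` Bur n"
proof
  fix A assume A: "A \<in> Mat n"
  define k l where "k = dim_row A" and "l = dim_col A"
  define f where "f = (\<lambda>(a, b). if a \<in> {1..k} \<and> b \<in> {1..l} then A $$ (a - 1, b - 1) else 0)"
  have "{p. 0 < f p} \<subseteq> {1..k} \<times> {1..l}" by (auto simp: f_def split: if_splits)
  then have fin: "finite {p. 0 < f p}" by (rule finite_subset) simp
  obtain ys where ys: "mset ys = Abs_multiset f" using ex_mset by blast
  define xs where "xs = sort_key burge_key ys"
  have count: "count_list xs p = f p" for p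
    using count_Abs_multiset[of f, OF fin] ys
    unfolding xs_def count_mset[symmetric] by simp
  have set: "set xs \<subseteq> {1..k} \<times> {1..l}"
  proof
    fix p assume "p \<in> set xs"
    then have "f p \<noteq> 0" using count[of p] by (metis count_list_0_iff)
    then show "p \<in> {1..k} \<times> {1..l}" by (auto simp: f_def split: if_splits prod.splits)
  qed
  have "length xs = (\<Sum>p\<in>{1..k} \<times> {1..l}. count_list xs p)"
    using set by (simp add: sum_count_set)
  also have "\<dots> = (\<Sum>a\<in>{1..k}. \<Sum>b\<in>{1..l}. f (a, b))"
    by (simp add: count sum.cartesian_product)
  also have "\<dots> = (\<Sum>i<k. \<Sum>j<l. A $$ (i, j))"
    by (simp add: sum.atLeast1_atMost_eq f_def)
  also have "\<dots> = n" using A by (simp add: Mat_def k_def l_def)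
  finally have len: "length xs = n" .
  obtain u v where ext: "u \<in> extensional {1..n}" "v \<in> extensional {1..n}" and xs: "biword n u v = xs"
    using exists_biword[OF len] by blast
  have mem: "(Suc i, Suc j) \<in> set xs \<longleftrightarrow> A $$ (i, j) \<noteq> 0" if "i < k" "j < l" for i j
    using that count_list_0_iff[of xs "(Suc i, Suc j)"] count[of "(Suc i, Suc j)"]
    by (auto simp: f_def)
  have u: "u ` {1..n} = {1..k}"
  proof
    show "u ` {1..n} \<subseteq> {1..k}" unfolding fst_set_biword[of n u v, symmetric] xs using set by auto
    show "{1..k} \<subseteq> u ` {1..n}"
    proof
      fix a assume "a \<in> {1..k}"
      then obtain i where i: "a = Suc i" "i < k" by (cases a) auto
      then obtain j where "j < l" "A $$ (i, j) \<noteq> 0" using A by (auto simp: Mat_def k_def l_def)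
      then have "(a, Suc j) \<in> set xs" using mem i by simp
      then show "a \<in> u ` {1..n}" unfolding fst_set_biword[of n u v, symmetric] xs by force
    qed
  qed
  have v: "v ` {1..n} = {1..l}"
  proof
    show "v ` {1..n} \<subseteq> {1..l}" unfolding snd_set_biword[of n u v, symmetric] xs using set by auto
    show "{1..l} \<subseteq> v ` {1..n}"
    proof
      fix b assume "b \<in> {1..l}"
      then obtain j where j: "b = Suc j" "j < l" by (cases b) auto
      then obtain i where "i < k" "A $$ (i, j) \<noteq> 0" using A by (auto simp: Mat_def k_def l_def)
      then have "(Suc i, b) \<in> set xs" using mem j by simp
      then show "b \<in> v ` {1..n}" unfolding snd_set_biword[of n u v, symmetric] xs by force
    qed
  qed
  have "(u, v) \<in> Bur n"
    using ext u v unfolding Bur_iff Cay_iff xs by (auto simp: xs_def)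
  moreover have "burge_matrix n (u, v) = A"
    using u v by (intro eq_matI) (auto simp: burge_matrix_def xs count f_def k_def l_def)
  ultimately show "A \<in> burge_matrix n ` Bur n" by force
qed

lemma bij_betw_burge_matrix: "bij_betw (burge_matrix n) (Bur n) (Mat n)"
proof (rule bij_betw_imageI[OF inj_on_burge_matrix equalityI])
  show "burge_matrix n ` Bur n \<subseteq> Mat n"
    by (auto intro: burge_matrix_in_Mat)
qed (rule Mat_subset_burge_matrix)

section \<open>Matrices with entries 0 and 1, and permutations\<close>

lemma distinct_iff_count_list_le_1: "distinct xs \<longleftrightarrow> (\<forall>x. count_list xs x \<le> 1)"
proof (induction xs)
  case (Cons x xs)
  show ?case
  proof
    assume "distinct (x # xs)"
    then show "\<forall>y. count_list (x # xs) y \<le> 1" using Cons by (simp add: count_list_0_iff)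
  next
    assume *: "\<forall>y. count_list (x # xs) y \<le> 1"
    have "count_list xs y \<le> 1" for y using *[rule_format, of y] by (simp split: if_splits)
    moreover have "count_list xs x = 0" using *[rule_format, of x] by simp
    ultimately show "distinct (x # xs)" using Cons by (simp add: count_list_0_iff)
  qed
qed simp

lemma burge_matrix_in_Mat01_iff:
  assumes "(u, v) \<in> Bur n"
  shows "burge_matrix n (u, v) \<in> Mat01 n \<longleftrightarrow> (u, v) \<in> Bur01 n"
proof -
  obtain k l where kl: "u ` {1..n} = {1..k}" "v ` {1..n} = {1..l}"
    using assms by (auto simp: Bur_iff Cay_iff)
  have dim: "dim_row (burge_matrix n (u, v)) = k" "dim_col (burge_matrix n (u, v)) = l"
    using kl by (simp_all add: burge_matrix_def)
  have "burge_matrix n (u, v) \<in> Mat01 n \<longleftrightarrow> (\<forall>i<k. \<forall>j<l. burge_matrix n (u, v) $$ (i, j) \<le> 1)"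
    using burge_matrix_in_Mat[OF assms]
    by (force simp: Mat01_def elements_mat_def dim le_Suc_eq UN_subset_iff image_subset_iff)
  also have "\<dots> \<longleftrightarrow> (\<forall>a b. count_list (biword n u v) (a, b) \<le> 1)"
  proof
    assume "\<forall>i<k. \<forall>j<l. burge_matrix n (u, v) $$ (i, j) \<le> 1"
    then show "\<forall>a b. count_list (biword n u v) (a, b) \<le> 1"
      unfolding count_list_biword_eq_entry[OF kl] by auto
  next
    assume "\<forall>a b. count_list (biword n u v) (a, b) \<le> 1"
    then show "\<forall>i<k. \<forall>j<l. burge_matrix n (u, v) $$ (i, j) \<le> 1"
      using kl by (simp add: burge_matrix_def)
  qed
  also have "\<dots> \<longleftrightarrow> distinct (biword n u v)"
    by (simp add: distinct_iff_count_list_le_1)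
  also have "\<dots> \<longleftrightarrow> (u, v) \<in> Bur01 n"
    using assms distinct_biword_iff by (simp add: Bur01_def Bur_iff)
  finally show ?thesis .
qed

lemma burge_matrix_in_Mat_perm_iff:
  assumes "(u, v) \<in> Bur n"
  shows "burge_matrix n (u, v) \<in> Mat_perm n \<longleftrightarrow> (u, v) \<in> Bur_perm n"
proof -
  obtain k l where kl: "u ` {1..n} = {1..k}" "v ` {1..n} = {1..l}"
    using assms by (auto simp: Bur_iff Cay_iff)
  have dim: "dim_row (burge_matrix n (u, v)) = k" "dim_col (burge_matrix n (u, v)) = l"
    using kl by (simp_all add: burge_matrix_def)
  have "burge_matrix n (u, v) \<in> Mat_perm n \<longleftrightarrow> (\<forall>j<l. count_list (map v [1..<Suc n]) (Suc j) = 1)"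
    using burge_matrix_in_Mat[OF assms] burge_matrix_column_sum[OF kl]
    by (simp add: Mat_perm_def dim del: upt_Suc)
  also have "\<dots> \<longleftrightarrow> (\<forall>b\<in>{1..l}. count_list (map v [1..<Suc n]) b = 1)"
    by (metis One_nat_def Suc_le_lessD Suc_le_eq Suc_pred atLeastAtMost_iff le_Suc_eq le_add1 plus_1_eq_Suc)
  also have "\<dots> \<longleftrightarrow> distinct (map v [1..<Suc n])"
  proof -
    have "set (map v [1..<Suc n]) = {1..l}" using kl by (simp add: atLeastLessThanSuc_atLeastAtMost del: upt_Suc)
    then have "0 < count_list (map v [1..<Suc n]) b \<longleftrightarrow> b \<in> {1..l}" for b
      using count_list_pos_iff by metis
    then show ?thesis unfolding distinct_iff_count_list_le_1
      by (metis One_nat_def Suc_leI le_antisym not_gr_zero order_refl zero_le_one)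
  qed
  also have "\<dots> \<longleftrightarrow> inj_on v {1..n}"
    by (simp add: distinct_map atLeastLessThanSuc_atLeastAtMost del: upt_Suc)
  also have "\<dots> \<longleftrightarrow> (u, v) \<in> Bur_perm n"
    using assms Sym_iff_inj_on by (simp add: Bur_perm_def Bur_iff)
  finally show ?thesis .
qed

section \<open>Counting Burge words and matrices\<close>

theorem theorem5p1:
  fixes n :: nat
  shows "(poly (weak_Caylerian n) 2 = int (card (Bur n)) \<and> card (Bur n) = card (Mat n)) \<and>
         (poly (strict_Caylerian n) 2 = int (card (Bur01 n)) \<and> card (Bur01 n) = card (Mat01 n)) \<and>
         (poly (Eulerian n) 2 = int (card (Bur_perm n)) \<and> card (Bur_perm n) = card (Mat_perm n))"
proof (intro conjI)
  have weak: "weak_descents n v \<subseteq> {1..n - 1}" and strict: "strict_descents n v \<subseteq> {1..n - 1}"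
    and strict_weak: "strict_descents n v \<subseteq> weak_descents n v" for v
    by (auto simp: weak_descents_def strict_descents_def)
  have fin: "finite (Sym n)" using finite_subset[OF Sym_subset_Cay finite_Cay] .
  show "poly (weak_Caylerian n) 2 = int (card (Bur n))"
    unfolding weak_Caylerian_def wdes_def Bur_def
    using descent_polynomial_at_2[OF finite_Cay weak] by simp
  have "Bur01 n = {(u, v) \<in> Inc n \<times> Cay n. weak_descents n u \<subseteq> strict_descents n v}"
    using strict_weak by (fastforce simp: Bur01_def Bur_def)
  then show "poly (strict_Caylerian n) 2 = int (card (Bur01 n))"
    unfolding strict_Caylerian_def sdes_def
    using descent_polynomial_at_2[OF finite_Cay strict] by simp
  have "Bur_perm n = {(u, v) \<in> Inc n \<times> Sym n. weak_descents n u \<subseteq> weak_descents n v}"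
    using Sym_subset_Cay by (fastforce simp: Bur_perm_def Bur_def)
  then show "poly (Eulerian n) 2 = int (card (Bur_perm n))"
    unfolding Eulerian_def wdes_def
    using descent_polynomial_at_2[OF fin weak] by simp
  \<comment> \<open>a subfamily that the bijection preserves and reflects has the same size on both sides\<close>
  have transfer: "card X = card Y"
    if "X \<subseteq> Bur n" "Y \<subseteq> Mat n" "\<And>u v. (u, v) \<in> Bur n \<Longrightarrow> burge_matrix n (u, v) \<in> Y \<longleftrightarrow> (u, v) \<in> X" for X Y
  proof -
    have "burge_matrix n ` X = Y"
    proof
      show "burge_matrix n ` X \<subseteq> Y" using that by fast
      show "Y \<subseteq> burge_matrix n ` X"
        using that bij_betw_imp_surj_on[OF bij_betw_burge_matrix[of n]] by fast
    qed
    then show ?thesis using bij_betw_subset[OF bij_betw_burge_matrix that(1)] bij_betw_same_card by blast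
  qed
  show "card (Bur n) = card (Mat n)"
    by (rule bij_betw_same_card[OF bij_betw_burge_matrix])
  show "card (Bur01 n) = card (Mat01 n)"
    by (rule transfer[OF _ _ burge_matrix_in_Mat01_iff]) (auto simp: Bur01_def Mat01_def)
  show "card (Bur_perm n) = card (Mat_perm n)"
    by (rule transfer[OF _ _ burge_matrix_in_Mat_perm_iff]) (auto simp: Bur_perm_def Mat_perm_def)
qed

end
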